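(* Let $n>2$, let $x_1,\dots,x_n$ be pairwise uncorrelated real-valued random variables with positive finite variances $\sigma_1^2,\dots,\sigma_n^2$, and let $\nu_i=1/\sigma_i^2$. For $1\le k\le n$ let $y_k(x_1,\dots,x_k)$ denote the optimal linear fusion of $x_1,\dots,x_k$ and $\nu_{y_k}$ its precision, as defined in the context. Then $$y_n(x_1,\dots,x_n)=\frac{\nu_{y_{n-1}}}{\nu_{y_{n-1}}+\nu_n}\,y_{n-1}(x_1,\dots,x_{n-1})+\frac{\nu_n}{\nu_{y_{n-1}}+\nu_n}\,x_n,\qquad \nu_{y_n}=\nu_{y_{n-1}}+\nu_n,$$ that is, $y_n(x_1,\dots,x_n)=y_2(y_{n-1}(x_1,\dots,x_{n-1}),x_n)$. Consequently, fusing the estimates incrementally, two at a time, yields the optimal fused estimate: $$y_n(x_1,x_2,\dots,x_n)=y_2(\dots y_2(y_2(x_1,x_2),x_3)\dots,x_n).$$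
   Context: For pairwise uncorrelated random variables $x_1,\dots,x_k$ with variances $\sigma_i^2>0$ and precisions $\nu_i=1/\sigma_i^2$, the optimal (minimum-variance) linear estimator with weights summing to $1$ is $$y_k(x_1,\dots,x_k)=\sum_{i=1}^k\frac{\nu_i}{\nu_1+\dots+\nu_k}\,x_i,$$ and its precision (the reciprocal of its variance) is $\nu_{y_k}=\sum_{i=1}^k\nu_i$. In particular, for two uncorrelated estimates $a,b$ with precisions $\nu_a,\nu_b$, $y_2(a,b)=\frac{\nu_a}{\nu_a+\nu_b}a+\frac{\nu_b}{\nu_a+\nu_b}b$. In a nested expression such as $y_2(y_{k-1}(x_1,\dots,x_{k-1}),x_k)$, the precision used for the first argument is $\nu_{y_{k-1}}$ and the precision used for the second is $\nu_k$. *)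

theory Defs
  imports "HOL-Probability.Probability"
begin

definition covariance :: "'a measure \<Rightarrow> ('a \<Rightarrow> real) \<Rightarrow> ('a \<Rightarrow> real) \<Rightarrow> real" where
  "covariance M X Y =
     prob_space.expectation M (\<lambda>\<omega>. (X \<omega> - prob_space.expectation M X) * (Y \<omega> - prob_space.expectation M Y))"

definition uncorrelated :: "'a measure \<Rightarrow> ('a \<Rightarrow> real) \<Rightarrow> ('a \<Rightarrow> real) \<Rightarrow> bool" where
  "uncorrelated M X Y \<longleftrightarrow> covariance M X Y = 0"

definition precision :: "'a measure \<Rightarrow> ('a \<Rightarrow> real) \<Rightarrow> real" where
  "precision M X = 1 / prob_space.variance M X"

text \<open>The estimator \<open>y\<^sub>k(x\<^sub>1, \<dots>, x\<^sub>k)\<close>. The lemma \<open>fusion_unique_minimum\<close> below shows that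
  it is the minimum-variance linear combination with weights summing to 1.\<close>

definition fusion :: "'a measure \<Rightarrow> (nat \<Rightarrow> 'a \<Rightarrow> real) \<Rightarrow> nat \<Rightarrow> 'a \<Rightarrow> real" where
  "fusion M x k = (\<lambda>\<omega>. \<Sum>i=1..k. precision M (x i) / (\<Sum>j=1..k. precision M (x j)) * x i \<omega>)"

text \<open>The case \<open>y\<^sub>2(a, b)\<close>. The weights use the precisions of the random variables \<open>a\<close> and \<open>b\<close>
  themselves, so an argument that is itself a fused estimate enters with its own precision.\<close>

definition fusion2 :: "'a measure \<Rightarrow> ('a \<Rightarrow> real) \<Rightarrow> ('a \<Rightarrow> real) \<Rightarrow> 'a \<Rightarrow> real" where
  "fusion2 M a b = fusion M (\<lambda>i. if i = 1 then a else b) 2"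

lemma fusion2_eq:
  "fusion2 M a b = (\<lambda>\<omega>. precision M a / (precision M a + precision M b) * a \<omega>
                       + precision M b / (precision M a + precision M b) * b \<omega>)"
proof -
  have "{1..2::nat} = {1, 2}" by auto
  then show ?thesis by (simp add: fusion2_def fusion_def)
qed

context
  fixes M :: "'a measure" and x :: "nat \<Rightarrow> 'a \<Rightarrow> real" and k :: nat
  assumes prob: "prob_space M"
    and k: "1 \<le> k"
    and rv: "\<And>i. i \<in> {1..k} \<Longrightarrow> x i \<in> borel_measurable M"
    and sq: "\<And>i. i \<in> {1..k} \<Longrightarrow> integrable M (\<lambda>\<omega>. (x i \<omega>)\<^sup>2)"
    and unc: "pairwise (\<lambda>i j. uncorrelated M (x i) (x j)) {1..k}"
    and pos: "\<And>i. i \<in> {1..k} \<Longrightarrow> 0 < prob_space.variance M (x i)"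
begin

lemma variance_linear_combination:
  "prob_space.variance M (\<lambda>\<omega>. \<Sum>i=1..k. w i * x i \<omega>) = (\<Sum>i=1..k. (w i)\<^sup>2 * prob_space.variance M (x i))"
proof -
  interpret prob_space M by (rule prob)
  define c where "c i = (\<lambda>\<omega>. x i \<omega> - expectation (x i))" for i
  have int: "integrable M (x i)" if "i \<in> {1..k}" for i
    using square_integrable_imp_integrable[OF rv[OF that] sq[OF that]] .
  have c_m: "c i \<in> borel_measurable M" if "i \<in> {1..k}" for i
    using rv[OF that] by (simp add: c_def)
  have c_sq: "integrable M (\<lambda>\<omega>. (c i \<omega>)\<^sup>2)" if "i \<in> {1..k}" for i
    using int[OF that] sq[OF that] by (simp add: c_def power2_diff)
  have c_int: "integrable M (\<lambda>\<omega>. c i \<omega> * c j \<omega>)" if "i \<in> {1..k}" "j \<in> {1..k}" for i j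
  proof (rule Bochner_Integration.integrable_bound)
    show "integrable M (\<lambda>\<omega>. (c i \<omega>)\<^sup>2 + (c j \<omega>)\<^sup>2)"
      using c_sq that by simp
    show "(\<lambda>\<omega>. c i \<omega> * c j \<omega>) \<in> borel_measurable M"
      using c_m that by simp
    have "\<bar>a * b\<bar> \<le> a\<^sup>2 + b\<^sup>2" for a b :: real
    proof -
      have "2 * (\<bar>a\<bar> * \<bar>b\<bar>) \<le> a\<^sup>2 + b\<^sup>2"
        using sum_squares_bound[of "\<bar>a\<bar>" "\<bar>b\<bar>"] by (simp only: power2_abs mult.assoc)
      moreover have "0 \<le> \<bar>a\<bar> * \<bar>b\<bar>" by (intro mult_nonneg_nonneg abs_ge_zero)
      ultimately show ?thesis unfolding abs_mult by linarith
    qed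
    then have "norm (c i \<omega> * c j \<omega>) \<le> norm ((c i \<omega>)\<^sup>2 + (c j \<omega>)\<^sup>2)" for \<omega>
      unfolding real_norm_def by (rule order_trans) (rule abs_ge_self)
    then show "AE \<omega> in M. norm (c i \<omega> * c j \<omega>) \<le> norm ((c i \<omega>)\<^sup>2 + (c j \<omega>)\<^sup>2)"
      by (rule AE_I2)
  qed
  have c_cov: "expectation (\<lambda>\<omega>. c i \<omega> * c j \<omega>) = (if i = j then variance (x i) else 0)"
    if "i \<in> {1..k}" "j \<in> {1..k}" for i j
    using unc that by (auto simp: c_def pairwise_def uncorrelated_def covariance_def power2_eq_square)
  have "expectation (\<lambda>\<omega>. \<Sum>i=1..k. w i * x i \<omega>) = (\<Sum>i=1..k. w i * expectation (x i))"
    using int by (simp add: Bochner_Integration.integral_sum)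
  then have "variance (\<lambda>\<omega>. \<Sum>i=1..k. w i * x i \<omega>) = expectation (\<lambda>\<omega>. (\<Sum>i=1..k. w i * c i \<omega>)\<^sup>2)"
    by (simp add: c_def right_diff_distrib sum_subtractf)
  also have "\<dots> = expectation (\<lambda>\<omega>. \<Sum>i=1..k. \<Sum>j=1..k. (w i * w j) * (c i \<omega> * c j \<omega>))"
    by (simp add: power2_eq_square sum_product mult_ac)
  also have "\<dots> = (\<Sum>i=1..k. \<Sum>j=1..k. (w i * w j) * expectation (\<lambda>\<omega>. c i \<omega> * c j \<omega>))"
    by (subst Bochner_Integration.integral_sum,
        intro Bochner_Integration.integrable_sum integrable_mult_right c_int; assumption?)
      (intro sum.cong refl, subst Bochner_Integration.integral_sum,
        auto intro!: integrable_mult_right c_int)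
  also have "\<dots> = (\<Sum>i=1..k. \<Sum>j=1..k. if i = j then (w i)\<^sup>2 * variance (x i) else 0)"
    using c_cov by (intro sum.cong refl) (auto simp: power2_eq_square)
  also have "\<dots> = (\<Sum>i=1..k. (w i)\<^sup>2 * variance (x i))"
    by (simp add: sum.delta')
  finally show ?thesis .
qed

lemma sum_precision_pos: "0 < (\<Sum>i=1..k. precision M (x i))"
  using k pos by (intro sum_pos) (auto simp: precision_def)

lemma variance_excess:
  assumes w: "(\<Sum>i=1..k. w i) = 1"
  shows "prob_space.variance M (\<lambda>\<omega>. \<Sum>i=1..k. w i * x i \<omega>) =
    1 / (\<Sum>j=1..k. precision M (x j)) +
    (\<Sum>i=1..k. prob_space.variance M (x i) * (w i - precision M (x i) / (\<Sum>j=1..k. precision M (x j)))\<^sup>2)"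
proof -
  define N where "N = (\<Sum>j=1..k. precision M (x j))"
  have N: "N > 0" using sum_precision_pos by (simp add: N_def)
  have "prob_space.variance M (x i) * (w i - precision M (x i) / N)\<^sup>2 =
      (w i)\<^sup>2 * prob_space.variance M (x i) - 2 / N * w i + precision M (x i) / N\<^sup>2"
    if "i \<in> {1..k}" for i
    using pos[OF that] N by (simp add: precision_def power2_eq_square field_simps)
  then have "(\<Sum>i=1..k. prob_space.variance M (x i) * (w i - precision M (x i) / N)\<^sup>2) =
      (\<Sum>i=1..k. (w i)\<^sup>2 * prob_space.variance M (x i)) - 2 / N * (\<Sum>i=1..k. w i) + N / N\<^sup>2"
    by (simp add: sum.distrib sum_subtractf sum_distrib_left N_def sum_divide_distrib)
  then show ?thesis
    using N unfolding variance_linear_combination N_def[symmetric] w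
    by (simp add: power2_eq_square)
qed

lemma sum_fusion_weights:
  "(\<Sum>i=1..k. precision M (x i) / (\<Sum>j=1..k. precision M (x j))) = 1"
  using sum_precision_pos by (simp add: sum_divide_distrib[symmetric])

lemma precision_fusion: "precision M (fusion M x k) = (\<Sum>i=1..k. precision M (x i))"
  unfolding fusion_def precision_def[of M "\<lambda>\<omega>. \<Sum>i=1..k. _ i * x i \<omega>"]
  by (subst variance_excess[OF sum_fusion_weights]) simp

lemma fusion_unique_minimum:
  assumes w: "(\<Sum>i=1..k. w i) = 1"
  shows "prob_space.variance M (fusion M x k) \<le> prob_space.variance M (\<lambda>\<omega>. \<Sum>i=1..k. w i * x i \<omega>)"
    and "prob_space.variance M (\<lambda>\<omega>. \<Sum>i=1..k. w i * x i \<omega>) \<le> prob_space.variance M (fusion M x k) \<Longrightarrow>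
      i \<in> {1..k} \<Longrightarrow> w i = precision M (x i) / (\<Sum>j=1..k. precision M (x j))"
proof -
  let ?d = "\<lambda>i. prob_space.variance M (x i) * (w i - precision M (x i) / (\<Sum>j=1..k. precision M (x j)))\<^sup>2"
  have d: "0 \<le> ?d i" if "i \<in> {1..k}" for i
    using pos[OF that] by simp
  have v: "prob_space.variance M (fusion M x k) = 1 / (\<Sum>j=1..k. precision M (x j))"
    unfolding fusion_def by (subst variance_excess[OF sum_fusion_weights]) simp
  show "prob_space.variance M (fusion M x k) \<le> prob_space.variance M (\<lambda>\<omega>. \<Sum>i=1..k. w i * x i \<omega>)"
    unfolding v variance_excess[OF w] using sum_nonneg[of "{1..k}" ?d] d by simp
  assume "prob_space.variance M (\<lambda>\<omega>. \<Sum>i=1..k. w i * x i \<omega>) \<le> prob_space.variance M (fusion M x k)"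
    and i: "i \<in> {1..k}"
  then have "sum ?d {1..k} \<le> 0"
    unfolding v variance_excess[OF w] by simp
  then have "sum ?d {1..k} = 0"
    using sum_nonneg[of "{1..k}" ?d] d by (intro antisym) auto
  then have "?d i = 0"
    using sum_nonneg_eq_0_iff[of "{1..k}" ?d] d i by blast
  then show "w i = precision M (x i) / (\<Sum>j=1..k. precision M (x j))"
    using pos[OF i] by auto
qed

end

end

theory Submission
  imports Defs
begin

text \<open>Up to normalisation, an optimal fused estimate is the precision-weighted sum of its
  inputs, and its own precision is exactly the normalising constant \<open>N\<close>, the sum of
  their precisions (\<open>precision_fusion\<close>). Weighting \<open>fusion M x k\<close> by its
  precision therefore restores the unnormalised sum, so fusing it with one more estimate only adds a
  term to numerator and denominator (\<open>fusion_Suc\<close>). Iterating this from a single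
  estimate gives the left fold.\<close>

lemma fusion_Suc:
  assumes prec: "precision M (fusion M x k) = (\<Sum>i=1..k. precision M (x i))"
    and pos: "0 < (\<Sum>i=1..k. precision M (x i))"
  shows "fusion M x (Suc k) = fusion2 M (fusion M x k) (x (Suc k))"
proof
  fix \<omega>
  define N where "N = (\<Sum>i=1..k. precision M (x i))"
  have N: "0 < N"
    using pos by (simp add: N_def)
  have "fusion M x k \<omega> = (\<Sum>i=1..k. precision M (x i) * x i \<omega>) / N"
    by (simp add: fusion_def N_def sum_divide_distrib)
  \<comment> \<open>The key cancellation: by \<open>prec\<close>, \<open>N\<close> is also the
    weight that \<open>fusion2\<close> gives its first argument.\<close>
  then have "N * fusion M x k \<omega> = (\<Sum>i=1..k. precision M (x i) * x i \<omega>)"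
    using N by simp
  moreover have "fusion M x (Suc k) \<omega> =
      ((\<Sum>i=1..k. precision M (x i) * x i \<omega>) + precision M (x (Suc k)) * x (Suc k) \<omega>)
        / (N + precision M (x (Suc k)))"
    by (simp add: fusion_def N_def sum_divide_distrib add_divide_distrib)
  ultimately show "fusion M x (Suc k) \<omega> = fusion2 M (fusion M x k) (x (Suc k)) \<omega>"
    unfolding fusion2_eq prec N_def[symmetric] by (simp add: add_divide_distrib)
qed

lemma fusion_1:
  assumes "precision M (x 1) \<noteq> 0"
  shows "fusion M x 1 = x 1"
  using assms by (simp add: fusion_def)

theorem mainTheorem3:
  fixes M :: "'a measure" and x :: "nat \<Rightarrow> 'a \<Rightarrow> real" and n :: nat
  assumes "prob_space M"
    and "n > 2"
    and "\<And>i. i \<in> {1..n} \<Longrightarrow> x i \<in> borel_measurable M"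
    and "\<And>i. i \<in> {1..n} \<Longrightarrow> integrable M (\<lambda>\<omega>. (x i \<omega>)\<^sup>2)"
    and "\<And>i. i \<in> {1..n} \<Longrightarrow> prob_space.variance M (x i) > 0"
    and "pairwise (\<lambda>i j. uncorrelated M (x i) (x j)) {1..n}"
  shows "fusion M x n =
      (\<lambda>\<omega>. precision M (fusion M x (n - 1)) / (precision M (fusion M x (n - 1)) + precision M (x n))
              * fusion M x (n - 1) \<omega>
          + precision M (x n) / (precision M (fusion M x (n - 1)) + precision M (x n)) * x n \<omega>)
    \<and> precision M (fusion M x n) = precision M (fusion M x (n - 1)) + precision M (x n)
    \<and> fusion M x n = fusion2 M (fusion M x (n - 1)) (x n)
    \<and> fusion M x n = foldl (fusion2 M) (x 1) (map x [2..<n + 1])"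
proof -
  \<comment> \<open>All hypotheses, pairwise uncorrelatedness included, restrict to the prefix
    \<open>{1..k}\<close>, so precisions add at every intermediate stage.\<close>
  have prec: "precision M (fusion M x k) = (\<Sum>i=1..k. precision M (x i))" if "1 \<le> k" "k \<le> n" for k
    using that assms by (intro precision_fusion pairwise_subset[OF assms(6)]) auto
  have pos: "0 < precision M (x i)" if "i \<in> {1..n}" for i
    using assms(5)[OF that] by (simp add: precision_def)
  have step: "fusion M x (Suc k) = fusion2 M (fusion M x k) (x (Suc k))" if "1 \<le> k" "k < n" for k
    using that pos by (intro fusion_Suc prec sum_pos) auto
  \<comment> \<open>The list holds the indices 2 to \<open>k\<close>: it is empty for
    \<open>k = 1\<close>, and passing to \<open>Suc k\<close> appends one entry, which
    \<open>foldl\<close> fuses last, as in \<open>step\<close>.\<close>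
  have fold: "fusion M x k = foldl (fusion2 M) (x 1) (map x [2..<k + 1])" if "1 \<le> k" "k \<le> n" for k
    using that
  proof (induction k rule: nat_induct_at_least)
    case base
    then show ?case
      using pos[of 1] fusion_1[of M x] by simp
  next
    case (Suc k)
    then show ?case
      using step[of k] by simp
  qed
  obtain m where m: "n = Suc m" "1 \<le> m"
    using \<open>n > 2\<close> by (cases n) auto
  have two: "fusion M x n = fusion2 M (fusion M x (n - 1)) (x n)"
    using step[of m] m by simp
  moreover have "precision M (fusion M x n) = precision M (fusion M x (n - 1)) + precision M (x n)"
    using prec[of m] prec[of n] m by simp
  ultimately show ?thesis
    using two[unfolded fusion2_eq] fold[of n] m by simp
qed

end
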